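(* Let $\pi$ be a non-trivial hereditary graph property that has a forbidden subgraph $H$ (a graph not having $\pi$) and is satisfied by all independent sets (edgeless graphs). Let $c(n)$ be an increasing function such that $c(n)\log c(n)=o\big(\sqrt{n/\log n}\big)$. Then any $c(n)$-competitive online algorithm with advice for $\textsc{Max-}\pi$ with preemption uses at least $\Omega\!\left(\frac{n}{c(n)^2\log c(n)}\right)$ bits of advice on inputs of length $n$.
   Context: A graph property is a collection of graphs; it is non-trivial if infinitely many graphs have it and infinitely many do not; it is hereditary if every induced subgraph of a graph with the property also has it. Online vertex-arrival model: an input is a graph $G$ with vertices $v_1,\dots,v_n$ presented one at a time; when $v_i$ is presented, all edges $\{v_j,v_i\}$ with $j<i$ are revealed; neither $G$ nor $n$ is known in advance. $\textsc{Max-}\pi$ with preemption: when a vertex arrives, the algorithm may accept or reject it, and may additionally preempt (discard) any previously accepted vertices; rejected or preempted vertices can never be accepted later. After each request, the current set $S$ of accepted, non-preempted vertices must induce a subgraph $G[S]$ with property $\pi$. The profit is the size of the final set $S$; the goal is to maximize it. Advice model: the algorithm has access to an infinite binary advice string $\phi$ (chosen with knowledge of the whole input), and its decisions at step $i$ may depend on $\phi$ and the vertices seen so far. An algorithm is $c$-competitive with advice complexity $b(n)$ if for every $n$ and every input $I$ of length at most $n$ there exists $\phi$ such that its profit on $I$ with advice $\phi$ is at least $\frac{1}{c}$ times the optimal profit on $I$, and at most the first $b(n)$ bits of $\phi$ are read. Logarithms are binary. *)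

theory Defs
  imports Complex_Main "HOL-Library.Ramsey" "HOL-Library.Landau_Symbols"
begin

(* Finite simple graphs. Every finite graph has an isomorphic copy on natural
   numbers; [V]\<^bsup>2\<^esup> (from Ramsey) is the set of two-element subsets of V. *)

datatype graph = Graph (verts: "nat set") (edges: "nat set set")

definition simple_graph :: "graph \<Rightarrow> bool" where
  "simple_graph G \<longleftrightarrow> finite (verts G) \<and> edges G \<subseteq> [verts G]\<^bsup>2\<^esup>"

definition induced :: "graph \<Rightarrow> nat set \<Rightarrow> graph" where
  "induced G S = Graph (verts G \<inter> S) (edges G \<inter> [S]\<^bsup>2\<^esup>)"

definition isomorphic :: "graph \<Rightarrow> graph \<Rightarrow> bool" where
  "isomorphic G H \<longleftrightarrow> (\<exists>f. bij_betw f (verts G) (verts H) \<and> edges H = (\<lambda>e. f ` e) ` edges G)"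

definition iso_rel :: "(graph \<times> graph) set" where
  "iso_rel = {(G, H). simple_graph G \<and> simple_graph H \<and> isomorphic G H}"

definition graph_property :: "graph set \<Rightarrow> bool" where
  "graph_property \<pi> \<longleftrightarrow>
     (\<forall>G\<in>\<pi>. simple_graph G) \<and>
     (\<forall>G H. G \<in> \<pi> \<longrightarrow> simple_graph H \<longrightarrow> isomorphic G H \<longrightarrow> H \<in> \<pi>)"

(* Graphs are counted up to isomorphism: otherwise the infinitely many
   labelled copies of a single nonempty graph would count as distinct. *)

definition nontrivial_property :: "graph set \<Rightarrow> bool" where
  "nontrivial_property \<pi> \<longleftrightarrow>
     infinite (\<pi> // iso_rel) \<and> infinite ((Collect simple_graph - \<pi>) // iso_rel)"

definition hereditary :: "graph set \<Rightarrow> bool" where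
  "hereditary \<pi> \<longleftrightarrow> (\<forall>G\<in>\<pi>. \<forall>S\<subseteq>verts G. induced G S \<in> \<pi>)"

(* Vertices of an input are named by their arrival positions, counted from 0,
   so that vertex names carry no information besides the order of arrival. *)

definition online_input :: "graph \<Rightarrow> bool" where
  "online_input G \<longleftrightarrow> simple_graph G \<and> (\<exists>n. verts G = {..<n})"

abbreviation input_length :: "graph \<Rightarrow> nat" where
  "input_length G \<equiv> card (verts G)"

type_synonym advice = "nat \<Rightarrow> bool"

(* From the advice and the graph revealed so far (including the new vertex),
   an algorithm decides whether to accept the new vertex and which of the
   previously accepted vertices to preempt. Its own earlier decisions are
   determined by these data, so they need not be an additional argument. *)

type_synonym algorithm = "advice \<Rightarrow> graph \<Rightarrow> bool \<times> nat set"

definition decision :: "algorithm \<Rightarrow> advice \<Rightarrow> graph \<Rightarrow> nat \<Rightarrow> bool \<times> nat set" where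
  "decision A \<phi> G i = A \<phi> (induced G {..i})"

(* kept A \<phi> G i is the set of accepted, non-preempted vertices after i requests. *)

primrec kept :: "algorithm \<Rightarrow> advice \<Rightarrow> graph \<Rightarrow> nat \<Rightarrow> nat set" where
  "kept A \<phi> G 0 = {}"
| "kept A \<phi> G (Suc i) =
     (case decision A \<phi> G i of (accept, preempt) \<Rightarrow>
        (kept A \<phi> G i - preempt) \<union> (if accept then {i} else {}))"

definition max_algorithm :: "graph set \<Rightarrow> algorithm \<Rightarrow> bool" where
  "max_algorithm \<pi> A \<longleftrightarrow>
     (\<forall>\<phi> G. online_input G \<longrightarrow> (\<forall>i\<le>input_length G. induced G (kept A \<phi> G i) \<in> \<pi>))"

definition profit :: "algorithm \<Rightarrow> advice \<Rightarrow> graph \<Rightarrow> nat" where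
  "profit A \<phi> G = card (kept A \<phi> G (input_length G))"

definition opt :: "graph set \<Rightarrow> graph \<Rightarrow> nat" where
  "opt \<pi> G = Max {card S | S. S \<subseteq> verts G \<and> induced G S \<in> \<pi>}"

(* Reading only the first k bits means that no decision on the input depends
   on the remaining bits. *)

definition reads_at_most :: "algorithm \<Rightarrow> advice \<Rightarrow> graph \<Rightarrow> nat \<Rightarrow> bool" where
  "reads_at_most A \<phi> G k \<longleftrightarrow>
     (\<forall>\<phi>'. (\<forall>j<k. \<phi>' j = \<phi> j) \<longrightarrow>
        (\<forall>i<input_length G. decision A \<phi>' G i = decision A \<phi> G i))"

definition competitive_with_advice ::
  "graph set \<Rightarrow> algorithm \<Rightarrow> (nat \<Rightarrow> real) \<Rightarrow> (nat \<Rightarrow> nat) \<Rightarrow> bool" where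
  "competitive_with_advice \<pi> A c b \<longleftrightarrow>
     (\<forall>n G. online_input G \<and> input_length G \<le> n \<longrightarrow>
        (\<exists>\<phi>. real (profit A \<phi> G) \<ge> 1 / c n * real (opt \<pi> G) \<and> reads_at_most A \<phi> G (b n)))"

end

theory Submission
  imports Defs
begin

text \<open>The adversary works in \<open>m\<close> rounds of \<open>q\<close> vertices, with \<open>q\<close> of order \<open>c log c\<close>. One hidden vertex
  per round has no edges to later rounds; apart from that the graph is a lexicographic product of two
  Ramsey graphs, in which every set of logarithmic size contains a copy of \<open>H\<close>. The hidden vertices are
  independent, so the optimum is at least \<open>m\<close>. The vertices that are not hidden induce a subgraph of the
  product, so the algorithm can keep only \<open>O(log q log m)\<close> of them, and at the end of a round it keeps
  only \<open>O(log q)\<close> of its \<open>q\<close> indistinguishable vertices. With fixed advice the hidden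
  vertex is therefore kept with probability at most \<open>1 / (4 c)\<close> per round. By an exponential moment bound, a
  given advice string serves only a fraction \<open>2 powr (- \<Omega>(m / c))\<close> of the choices of hidden vertices, so
  \<open>\<Omega>(m / c)\<close> bits are needed. The Ramsey graphs exist by a union bound: a set of size \<open>t\<close> has room for
  order \<open>t\<^sup>2\<close> pairwise edge-disjoint potential copies of \<open>H\<close>, which a random graph avoids independently.\<close>

section \<open>Ramsey graphs for a hereditary property, by a union bound\<close>

text \<open>Traces of a uniformly random edge set on disjoint blocks are independent, and each block
  rules out one of its \<open>2 ^ f\<close> traces. The induction peels off one block, since
  \<open>E\<close> is determined by \<open>E - F l\<close> and \<open>E \<inter> F l\<close>. The
  bound is multiplied out so that it stays within \<open>nat\<close>.\<close>

lemma card_avoiding_patterns: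
  assumes "finite I" "finite U"
    and "\<And>l. l \<in> I \<Longrightarrow> F l \<subseteq> U" "\<And>l. l \<in> I \<Longrightarrow> p l \<subseteq> F l" "\<And>l. l \<in> I \<Longrightarrow> card (F l) = f"
    and "\<And>l l'. l \<in> I \<Longrightarrow> l' \<in> I \<Longrightarrow> l \<noteq> l' \<Longrightarrow> F l \<inter> F l' = {}"
  shows "card {E \<in> Pow U. \<forall>l\<in>I. E \<inter> F l \<noteq> p l} * 2 ^ (f * card I)
           \<le> 2 ^ card U * (2 ^ f - 1) ^ card I"
  using assms
proof (induction I arbitrary: U rule: finite_induct)
  case empty
  then show ?case by (simp add: card_Pow Pow_def[symmetric])
next
  case (insert l I)
  let ?X = "{E \<in> Pow U. \<forall>l\<in>insert l I. E \<inter> F l \<noteq> p l}"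
  let ?Y = "{E \<in> Pow (U - F l). \<forall>l\<in>I. E \<inter> F l \<noteq> p l}"
  have Fl: "F l \<subseteq> U" "p l \<subseteq> F l" "card (F l) = f"
    using insert.prems by auto
  have finF: "finite (F l)" using Fl insert.prems(1) finite_subset by blast
  have dj: "F l \<inter> F i = {}" if "i \<in> I" for i
    using insert.prems(5)[of l i] insert.hyps that by auto
  have inj: "inj_on (\<lambda>E. (E - F l, E \<inter> F l)) ?X"
    by (auto simp: inj_on_def)
  have sub: "(\<lambda>E. (E - F l, E \<inter> F l)) ` ?X \<subseteq> ?Y \<times> (Pow (F l) - {p l})"
  proof (clarsimp, intro conjI ballI)
    fix E assume *: "E \<subseteq> U" "\<forall>l\<in>I. E \<inter> F l \<noteq> p l"
    show "E - F l \<subseteq> U - F l" using * by auto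
    fix i assume "i \<in> I"
    then have "(E - F l) \<inter> F i = E \<inter> F i" using dj by auto
    then show "(E - F l) \<inter> F i \<noteq> p i" using * \<open>i \<in> I\<close> by simp
  qed
  have "finite ?Y" using insert.prems(1) by auto
  then have fin: "finite (?Y \<times> (Pow (F l) - {p l}))" using finF by auto
  have cX: "card ?X \<le> card ?Y * (2 ^ f - 1)"
    using card_inj_on_le[OF inj sub fin] Fl finF
    by (simp add: card_cartesian_product card_Diff_singleton card_Pow)
  have IH: "card ?Y * 2 ^ (f * card I) \<le> 2 ^ card (U - F l) * (2 ^ f - 1) ^ card I"
  proof (rule insert.IH)
    show "finite (U - F l)" using insert.prems(1) by simp
    show "F i \<subseteq> U - F l" if "i \<in> I" for i using insert.prems(2)[of i] dj[OF that] that by auto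
  qed (use insert.prems in auto)
  have cU: "card U = card (U - F l) + f"
    using Fl insert.prems(1) finF by (metis card_Diff_subset card_mono le_add_diff_inverse2)
  have "card ?X * 2 ^ (f * card (insert l I)) \<le> card ?Y * (2 ^ f - 1) * (2 ^ (f * card I) * 2 ^ f)"
  proof -
    have "2 ^ (f * card (insert l I)) = (2 ^ (f * card I) * 2 ^ f :: nat)"
      using insert.hyps by (simp add: power_add)
    then show ?thesis using mult_le_mono1[OF cX] by (simp only:)
  qed
  also have "\<dots> = (card ?Y * 2 ^ (f * card I)) * ((2 ^ f - 1) * 2 ^ f)"
    by (simp only: ac_simps)
  also have "\<dots> \<le> (2 ^ card (U - F l) * (2 ^ f - 1) ^ card I) * ((2 ^ f - 1) * 2 ^ f)"
    using IH by (rule mult_right_mono) simp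
  also have "\<dots> = 2 ^ card U * (2 ^ f - 1) ^ card (insert l I)"
  proof -
    have "2 ^ card U = (2 ^ card (U - F l) * 2 ^ f :: nat)" by (metis cU power_add)
    then show ?thesis
      by (simp only: card_insert_disjoint[OF insert.hyps] power_Suc ac_simps)
  qed
  finally show ?case .
qed

text \<open>This closes a union bound over at most \<open>(2 ^ L) ^ t\<close> sets,
  \<open>t = k\<^sup>2 * P\<close>, each bad with probability at most
  \<open>(1 - d) ^ P\<^sup>2\<close> for \<open>d = 1 / 2 ^ f\<close>. The choice of
  \<open>P\<close> makes \<open>d * P\<^sup>2\<close> equal to the exponent
  \<open>L * k\<^sup>2 * P\<close>, so the comparison of 2 with the base of \<open>exp\<close>
  decides.\<close>

lemma union_bound_numeric:
  fixes k L f P :: nat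
  assumes "k \<ge> 1" "L \<ge> 1" "P = L * k\<^sup>2 * 2 ^ f"
  shows "2 ^ (L * (k\<^sup>2 * P)) * (2 ^ f - 1) ^ (P\<^sup>2) < (2::nat) ^ (f * P\<^sup>2)"
proof -
  let ?M = "L * (k\<^sup>2 * P)"
  define d :: real where "d = 1 / 2 ^ f"
  have d: "0 < d" "d \<le> 1" "1 - d = (2 ^ f - 1) / 2 ^ f" by (simp_all add: d_def field_simps)
  have M0: "?M > 0" using assms by simp
  have Md: "real (P\<^sup>2) * d = real ?M" by (simp add: d_def assms(3) power2_eq_square)
  have "(1 - d) ^ P\<^sup>2 \<le> exp (- d) ^ P\<^sup>2"
    using d exp_ge_add_one_self[of "-d"] by (intro power_mono) auto
  also have "\<dots> = exp (- real ?M)"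
    using Md by (simp add: exp_of_nat_mult[symmetric])
  finally have 1: "(1 - d) ^ P\<^sup>2 \<le> exp (- real ?M)" .
  have "(2::real) ^ ?M = exp (real ?M * ln 2)" by (subst exp_of_nat_mult) simp
  also have "\<dots> < exp (real ?M)" using ln_2_less_1 M0 by simp
  finally have 2: "(2::real) ^ ?M < exp (real ?M)" .
  have "(2::real) ^ ?M * (1 - d) ^ P\<^sup>2 \<le> 2 ^ ?M * exp (- real ?M)" using 1 by simp
  also have "\<dots> < exp (real ?M) * exp (- real ?M)" using 2 by (intro mult_strict_right_mono) auto
  also have "\<dots> = 1" by (simp add: exp_minus)
  finally have "(2::real) ^ ?M * (2 ^ f - 1) ^ P\<^sup>2 < 2 ^ (f * P\<^sup>2)"
    by (simp add: d(3) power_divide power_mult)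
  then have "real (2 ^ ?M * (2 ^ f - 1) ^ (P\<^sup>2)) < real (2 ^ (f * P\<^sup>2))"
    by (simp add: of_nat_diff)
  then show ?thesis by (simp only: of_nat_less_iff)
qed

lemma nsets_image_inj:
  assumes "inj_on f A"
  shows "[f ` A]\<^bsup>n\<^esup> = (\<lambda>e. f ` e) ` [A]\<^bsup>n\<^esup>"
proof (intro equalityI subsetI)
  fix e assume "e \<in> [f ` A]\<^bsup>n\<^esup>"
  then have e: "e \<subseteq> f ` A" "finite e" "card e = n" by (auto simp: nsets_def)
  then obtain e' where "e' \<subseteq> A" "e = f ` e'" by (meson subset_imageE)
  moreover have "inj_on f e'" using assms calculation inj_on_subset by blast
  ultimately show "e \<in> (\<lambda>e. f ` e) ` [A]\<^bsup>n\<^esup>"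
    using e by (auto simp: nsets_def card_image finite_image_iff)
next
  fix e assume "e \<in> (\<lambda>e. f ` e) ` [A]\<^bsup>n\<^esup>"
  then show "e \<in> [f ` A]\<^bsup>n\<^esup>"
    using assms by (auto simp: nsets_def card_image inj_on_subset)
qed

lemma isomorphic_image:
  assumes "simple_graph G" "inj_on f (verts G)"
  shows "simple_graph (Graph (f ` verts G) ((\<lambda>e. f ` e) ` edges G))"
    and "isomorphic G (Graph (f ` verts G) ((\<lambda>e. f ` e) ` edges G))"
    and "isomorphic (Graph (f ` verts G) ((\<lambda>e. f ` e) ` edges G)) G"
proof -
  show "simple_graph (Graph (f ` verts G) ((\<lambda>e. f ` e) ` edges G))"
    using assms by (auto simp: simple_graph_def nsets_image_inj)
  show "isomorphic G (Graph (f ` verts G) ((\<lambda>e. f ` e) ` edges G))"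
    using assms by (auto simp: isomorphic_def bij_betw_def)
  let ?i = "inv_into (verts G) f"
  have "?i ` f ` e = e" if "e \<in> edges G" for e
  proof (rule inv_into_image_cancel[OF assms(2)])
    show "e \<subseteq> verts G" using that assms(1) by (auto simp: simple_graph_def nsets_def)
  qed
  then have "edges G = (\<lambda>e. ?i ` e) ` (\<lambda>e. f ` e) ` edges G"
    by (auto simp: image_image)
  moreover have "bij_betw ?i (f ` verts G) (verts G)"
    using assms by (simp add: bij_betw_def inj_on_inv_into)
  ultimately show "isomorphic (Graph (f ` verts G) ((\<lambda>e. f ` e) ` edges G)) G"
    unfolding isomorphic_def by (metis graph.sel)
qed

lemma induced_Graph: "T \<subseteq> S \<Longrightarrow> induced (Graph S (E \<inter> [S]\<^bsup>2\<^esup>)) T = Graph T (E \<inter> [T]\<^bsup>2\<^esup>)"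
  using nsets_mono[of T S 2] by (auto simp: induced_def)

lemma hereditary_Graph:
  assumes "hereditary \<pi>" "Graph S (E \<inter> [S]\<^bsup>2\<^esup>) \<in> \<pi>" "T \<subseteq> S"
  shows "Graph T (E \<inter> [T]\<^bsup>2\<^esup>) \<in> \<pi>"
proof -
  have "induced (Graph S (E \<inter> [S]\<^bsup>2\<^esup>)) T \<in> \<pi>"
    using assms(1,2) assms(3) unfolding hereditary_def by (metis graph.sel(1))
  then show ?thesis using induced_Graph[OF assms(3)] by simp
qed

text \<open>The line of slope \<open>b\<close> through \<open>(0, a)\<close> selects one point in each of the \<open>k\<close> columns
  of a grid; two distinct lines share at most one point, so the pairs inside them are disjoint.\<close>
lemma line_column:
  fixes a b i k P :: nat
  assumes "a < P" "b < P" "i < k"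
  shows "(i * (P * k) + (a + b * i)) div (P * k) = i"
    and "(i * (P * k) + (a + b * i)) mod (P * k) = a + b * i"
    and "i * (P * k) + (a + b * i) < k * (P * k)"
proof -
  have "a + b * i < P + P * i" using assms by (intro add_less_le_mono) auto
  also have "\<dots> = P * Suc i" by simp
  also have "\<dots> \<le> P * k" using assms by (intro mult_le_mono2) auto
  finally have *: "a + b * i < P * k" .
  show "(i * (P * k) + (a + b * i)) div (P * k) = i"
    using * by (intro div_nat_eqI) auto
  show "(i * (P * k) + (a + b * i)) mod (P * k) = a + b * i" using * by simp
  have "i * (P * k) + (a + b * i) < Suc i * (P * k)" using * by simp
  also have "\<dots> \<le> k * (P * k)" using assms by (intro mult_le_mono1) auto
  finally show "i * (P * k) + (a + b * i) < k * (P * k)" .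
qed

lemma line_unique:
  fixes a b a' b' i j :: nat
  assumes "a + b * i = a' + b' * i" "a + b * j = a' + b' * j" "i \<noteq> j"
  shows "a = a' \<and> b = b'"
proof -
  have "int a + int b * int i = int a' + int b' * int i" "int a + int b * int j = int a' + int b' * int j"
    using assms(1,2) by (metis of_nat_add of_nat_mult)+
  then have "(int b - int b') * (int i - int j) = 0" by (simp add: algebra_simps)
  then have "b = b'" using assms(3) by simp
  then show ?thesis using assms by simp
qed

text \<open>View \<open>T\<close> as a grid of \<open>k\<close> columns of height
  \<open>P * k\<close>, and let the copy indexed by \<open>(a, b)\<close> send the vertex number
  \<open>i\<close> of \<open>W\<close> to height \<open>a + b * i\<close> of column
  \<open>i\<close>. Two copies with a common pair of vertices are lines through two common points,
  hence equal. The number of copies, \<open>P\<^sup>2\<close>, is quadratic in \<open>card T\<close>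
  for fixed \<open>k\<close>.\<close>

lemma disjoint_copies:
  fixes T :: "nat set" and k P :: nat
  assumes "finite W" "card W = k" "card T = k * (P * k)" "finite T"
  obtains emb :: "nat \<times> nat \<Rightarrow> nat \<Rightarrow> nat" where
    "\<And>l. l \<in> {..<P} \<times> {..<P} \<Longrightarrow> inj_on (emb l) W"
    "\<And>l. l \<in> {..<P} \<times> {..<P} \<Longrightarrow> emb l ` W \<subseteq> T"
    "\<And>l l'. l \<in> {..<P} \<times> {..<P} \<Longrightarrow> l' \<in> {..<P} \<times> {..<P} \<Longrightarrow> l \<noteq> l' \<Longrightarrow>
       [emb l ` W]\<^bsup>2\<^esup> \<inter> [emb l' ` W]\<^bsup>2\<^esup> = {}"
proof -
  obtain idx where idx: "bij_betw idx W {0..<k}"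
    using ex_bij_betw_finite_nat[OF assms(1)] assms(2) by auto
  obtain e where e: "bij_betw e {0..<k * (P * k)} T"
    using ex_bij_betw_nat_finite[OF assms(4)] assms(3) by auto
  define pos where "pos = (\<lambda>(a, b) v. idx v * (P * k) + (a + b * idx v))"
  define emb where "emb = (\<lambda>l v. e (pos l v))"
  have idxk: "idx v < k" if "v \<in> W" for v using idx that by (auto simp: bij_betw_def)
  have idxinj: "u = v" if "u \<in> W" "v \<in> W" "idx u = idx v" for u v
    using idx that by (auto simp: bij_betw_def inj_on_def)
  \<comment> \<open>A common point of two lines determines its column, hence the vertex of
    \<open>W\<close>, and its height within that column.\<close>
  have same: "u = v \<and> fst l + snd l * idx u = fst l' + snd l' * idx u"
    if l: "l \<in> {..<P} \<times> {..<P}" "l' \<in> {..<P} \<times> {..<P}" and uv: "u \<in> W" "v \<in> W"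
      and eq: "emb l u = emb l' v" for l l' u v
  proof -
    obtain a b a' b' where ab: "l = (a, b)" "l' = (a', b')" "a < P" "b < P" "a' < P" "b' < P"
      using l by auto
    note lu = line_column[OF ab(3,4) idxk[OF uv(1)]] and lv = line_column[OF ab(5,6) idxk[OF uv(2)]]
    have peq: "pos l u = pos l' v"
    proof (rule inj_onD[OF bij_betw_imp_inj_on[OF e]])
      show "e (pos l u) = e (pos l' v)" using eq by (simp add: emb_def)
    qed (use lu(3) lv(3) in \<open>simp_all add: pos_def ab\<close>)
    then have "idx u = idx v" using lu(1) lv(1) by (simp add: pos_def ab)
    then have "u = v" using idxinj uv by auto
    then show ?thesis using peq by (simp add: pos_def ab)
  qed
  show ?thesis
  proof (rule that[of emb])
    fix l assume l: "l \<in> {..<P} \<times> {..<P}"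
    show "inj_on (emb l) W" using same[OF l l] by (auto simp: inj_on_def)
    show "emb l ` W \<subseteq> T"
    proof
      fix x assume "x \<in> emb l ` W"
      then obtain v where v: "v \<in> W" "x = e (pos l v)" by (auto simp: emb_def)
      obtain a b where ab: "l = (a, b)" "a < P" "b < P" using l by auto
      have "pos l v < k * (P * k)"
        using line_column(3)[OF ab(2,3) idxk[OF v(1)]] by (simp add: pos_def ab)
      then show "x \<in> T" using e v(2) by (simp add: bij_betw_apply)
    qed
  next
    fix l l' assume l: "l \<in> {..<P} \<times> {..<P}" "l' \<in> {..<P} \<times> {..<P}" "l \<noteq> l'"
    show "[emb l ` W]\<^bsup>2\<^esup> \<inter> [emb l' ` W]\<^bsup>2\<^esup> = {}"
    proof (rule ccontr)
      assume "[emb l ` W]\<^bsup>2\<^esup> \<inter> [emb l' ` W]\<^bsup>2\<^esup> \<noteq> {}"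
      then obtain d where d: "d \<subseteq> emb l ` W" "d \<subseteq> emb l' ` W" "card d = 2"
        by (auto simp: nsets_def)
      then obtain x y where xy: "d = {x, y}" "x \<noteq> y" by (auto simp: card_2_iff)
      have "x \<in> emb l ` W" "y \<in> emb l ` W" "x \<in> emb l' ` W" "y \<in> emb l' ` W"
        using d xy by auto
      then obtain u v u' v' where w: "u \<in> W" "v \<in> W" "u' \<in> W" "v' \<in> W"
        "x = emb l u" "y = emb l v" "x = emb l' u'" "y = emb l' v'"
        by (elim imageE) metis
      have "fst l + snd l * idx u = fst l' + snd l' * idx u"
        "fst l + snd l * idx v = fst l' + snd l' * idx v"
        using same[OF l(1,2)] w by metis+
      moreover have "idx u \<noteq> idx v" using w xy idxinj by blast
      ultimately have "l = l'" using line_unique by (metis prod.collapse)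
      then show False using l by simp
    qed
  qed
qed

text \<open>The edge sets on \<open>2 ^ L\<close> vertices for which some \<open>t\<close>-subset
  induces a member of \<pi> are too few to be all of them: by heredity such a subset must avoid
  \<open>H\<close> on each of \<open>P\<^sup>2\<close> edge-disjoint placements. As \<open>P\<close>
  is linear in \<open>L\<close>, so is \<open>t\<close>, and \<open>K\<close> collects the factors
  that depend on \<open>H\<close> alone.\<close>

lemma ramsey_hosts:
  assumes \<pi>: "graph_property \<pi>" "hereditary \<pi>"
    and H: "simple_graph H" "H \<notin> \<pi>" "verts H \<noteq> {}"
  obtains K :: nat where "K \<ge> 1"
    "\<And>L. L \<ge> 1 \<Longrightarrow> \<exists>E. \<forall>S\<subseteq>{..<2 ^ L}. Graph S (E \<inter> [S]\<^bsup>2\<^esup>) \<in> \<pi> \<longrightarrow> card S < K * L"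
proof -
  let ?W = "verts H"
  define k where "k = card ?W"
  define f where "f = k choose 2"
  have finW: "finite ?W" using H by (simp add: simple_graph_def)
  have k1: "k \<ge> 1" using H finW by (simp add: k_def Suc_le_eq card_gt_0_iff)
  define K where "K = k\<^sup>2 * k\<^sup>2 * 2 ^ f"
  show ?thesis
  proof (rule that[of K])
    show "K \<ge> 1" using k1 by (simp add: K_def)
  next
    fix L :: nat assume L: "L \<ge> 1"
    define P where "P = L * k\<^sup>2 * 2 ^ f"
    define t where "t = k * (P * k)"
    have tK: "t = K * L" by (simp add: t_def P_def K_def power2_eq_square ac_simps)
    let ?V = "{..<2 ^ L::nat}"
    let ?U = "[?V]\<^bsup>2\<^esup>"
    let ?I = "{..<P} \<times> {..<P}"
    have finU: "finite ?U" by (simp add: finite_imp_finite_nsets)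
    define bad where "bad T = {E \<in> Pow ?U. Graph T (E \<inter> [T]\<^bsup>2\<^esup>) \<in> \<pi>}" for T
    define Ts where "Ts = {T. T \<subseteq> ?V \<and> card T = t}"
    have bad: "card (bad T) * 2 ^ (f * P\<^sup>2) \<le> 2 ^ card ?U * (2 ^ f - 1) ^ P\<^sup>2" if "T \<in> Ts" for T
    proof -
      have T: "T \<subseteq> ?V" "card T = k * (P * k)" "finite T"
        using that finite_subset[of T ?V] by (auto simp: Ts_def t_def)
      obtain emb where emb: "\<And>l. l \<in> ?I \<Longrightarrow> inj_on (emb l) ?W" "\<And>l. l \<in> ?I \<Longrightarrow> emb l ` ?W \<subseteq> T"
        "\<And>l l'. l \<in> ?I \<Longrightarrow> l' \<in> ?I \<Longrightarrow> l \<noteq> l' \<Longrightarrow> [emb l ` ?W]\<^bsup>2\<^esup> \<inter> [emb l' ` ?W]\<^bsup>2\<^esup> = {}"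
        using disjoint_copies[OF finW k_def[symmetric] T(2,3)] by metis
      define F where "F l = [emb l ` ?W]\<^bsup>2\<^esup>" for l
      define p where "p l = (\<lambda>e. emb l ` e) ` edges H" for l
      \<comment> \<open>If \<open>E\<close> agreed with the copy of \<open>H\<close> on one
        placement, heredity would put that copy, and hence \<open>H\<close> itself, into
        \<pi>.\<close>
      have sub: "bad T \<subseteq> {E \<in> Pow ?U. \<forall>l\<in>?I. E \<inter> F l \<noteq> p l}"
      proof (clarsimp simp: bad_def)
        fix E a b assume E: "Graph T (E \<inter> [T]\<^bsup>2\<^esup>) \<in> \<pi>" "a < P" "b < P" "E \<inter> F (a, b) = p (a, b)"
        let ?l = "(a, b)"
        have l: "?l \<in> ?I" using E by auto
        have "Graph (emb ?l ` ?W) (E \<inter> F ?l) \<in> \<pi>"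
          using hereditary_Graph[OF \<pi>(2) E(1) emb(2)[OF l]] by (simp add: F_def)
        then have "Graph (emb ?l ` ?W) (p ?l) \<in> \<pi>" using E by simp
        then have "H \<in> \<pi>"
          using isomorphic_image(3)[OF H(1) emb(1)[OF l]] \<pi>(1) H(1)
          unfolding graph_property_def p_def by blast
        then show False using H by simp
      qed
      have "card {E \<in> Pow ?U. \<forall>l\<in>?I. E \<inter> F l \<noteq> p l} * 2 ^ (f * card ?I)
           \<le> 2 ^ card ?U * (2 ^ f - 1) ^ card ?I"
      proof (rule card_avoiding_patterns)
        fix l assume l: "l \<in> ?I"
        show "F l \<subseteq> ?U" unfolding F_def using emb(2)[OF l] T(1) by (intro nsets_mono) auto
        show "p l \<subseteq> F l"
          unfolding F_def p_def nsets_image_inj[OF emb(1)[OF l]]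
          using H(1) by (auto simp: simple_graph_def)
        show "card (F l) = f"
          unfolding F_def f_def k_def by (simp add: card_nsets card_image[OF emb(1)[OF l]])
      qed (use finU emb(3) in \<open>auto simp: F_def\<close>)
      moreover have "card (bad T) \<le> card {E \<in> Pow ?U. \<forall>l\<in>?I. E \<inter> F l \<noteq> p l}"
        using finU by (intro card_mono sub) auto
      ultimately show ?thesis
        by (simp add: power2_eq_square) (meson le_trans mult_le_mono1)
    qed
    have "card Ts = 2 ^ L choose t"
      using n_subsets[of ?V t] by (simp add: Ts_def)
    also have "\<dots> \<le> (2 ^ L) ^ t"
      by (cases "t \<le> 2 ^ L") (simp_all add: binomial_le_pow binomial_eq_0)
    also have "\<dots> = 2 ^ (L * (k\<^sup>2 * P))"
      by (simp add: power_mult t_def power2_eq_square ac_simps)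
    finally have cT: "card Ts \<le> 2 ^ (L * (k\<^sup>2 * P))" .
    have finT: "finite Ts" by (auto simp: Ts_def)
    have "card (\<Union>T\<in>Ts. bad T) * 2 ^ (f * P\<^sup>2) \<le> (\<Sum>T\<in>Ts. card (bad T)) * 2 ^ (f * P\<^sup>2)"
      using card_UN_le[OF finT] by (intro mult_le_mono1)
    also have "\<dots> = (\<Sum>T\<in>Ts. card (bad T) * 2 ^ (f * P\<^sup>2))" by (simp add: sum_distrib_right)
    also have "\<dots> \<le> (\<Sum>T\<in>Ts. 2 ^ card ?U * (2 ^ f - 1) ^ P\<^sup>2)" by (intro sum_mono bad)
    also have "\<dots> = card Ts * (2 ^ card ?U * (2 ^ f - 1) ^ P\<^sup>2)" by simp
    also have "\<dots> \<le> 2 ^ (L * (k\<^sup>2 * P)) * (2 ^ card ?U * (2 ^ f - 1) ^ P\<^sup>2)"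
      using cT by (intro mult_le_mono1)
    also have "\<dots> = 2 ^ card ?U * (2 ^ (L * (k\<^sup>2 * P)) * (2 ^ f - 1) ^ P\<^sup>2)" by (simp only: ac_simps)
    also have "\<dots> < 2 ^ card ?U * 2 ^ (f * P\<^sup>2)"
      using union_bound_numeric[OF k1 L P_def] by simp
    finally have "card (\<Union>T\<in>Ts. bad T) < card (Pow ?U)" using finU by (simp add: card_Pow)
    moreover have "(\<Union>T\<in>Ts. bad T) \<subseteq> Pow ?U" by (auto simp: bad_def)
    ultimately have "(\<Union>T\<in>Ts. bad T) \<subset> Pow ?U" by (metis less_irrefl psubsetI)
    then obtain E where E: "E \<in> Pow ?U" "\<forall>T\<in>Ts. E \<notin> bad T" by blast
    show "\<exists>E. \<forall>S\<subseteq>?V. Graph S (E \<inter> [S]\<^bsup>2\<^esup>) \<in> \<pi> \<longrightarrow> card S < K * L"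
    proof (intro exI[of _ E] allI impI, rule ccontr)
      fix S assume S: "S \<subseteq> ?V" "Graph S (E \<inter> [S]\<^bsup>2\<^esup>) \<in> \<pi>" "\<not> card S < K * L"
      \<comment> \<open>Only sets of size exactly \<open>t\<close> were counted; heredity passes
        from a larger set to such a subset.\<close>
      then obtain T where T: "T \<subseteq> S" "card T = t"
        using obtain_subset_with_card_n[of t S] tK by (metis not_less)
      then have "T \<in> Ts" using S by (auto simp: Ts_def)
      moreover have "E \<in> bad T"
        using hereditary_Graph[OF \<pi>(2) S(2) T(1)] E by (simp add: bad_def)
      ultimately show False using E by blast
    qed
  qed
qed

section \<open>Runs of an online algorithm and truncation of advice\<close>

lemma kept_subset: "kept A \<phi> G i \<subseteq> {..<i}"
  by (induction i) (auto split: prod.splits)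

lemma kept_cong:
  "(\<And>j. j < i \<Longrightarrow> decision A \<phi> G j = decision A \<phi>' G' j) \<Longrightarrow> kept A \<phi> G i = kept A \<phi>' G' i"
  by (induction i) auto

text \<open>A vertex can enter the kept set only in the step of its own arrival, so a discarded
  vertex never returns.\<close>

lemma kept_antimono: "i \<le> k \<Longrightarrow> kept A \<phi> G k \<inter> {..<i} \<subseteq> kept A \<phi> G i"
proof (induction k rule: dec_induct)
  case (step k)
  have "kept A \<phi> G (Suc k) \<inter> {..<i} \<subseteq> kept A \<phi> G k \<inter> {..<i}"
    using step(1) by (auto split: prod.splits if_splits)
  then show ?case using step by blast
qed simp

text \<open>Setting all bits from position \<open>k\<close> on to \<open>False\<close> changes no
  decision. This leaves \<open>2 ^ k\<close> relevant strings, coded by the subsets of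
  \<open>{..<k}\<close>, over which one can sum.\<close>

lemma profit_truncated_advice:
  assumes "reads_at_most A \<phi> G k"
  shows "profit A \<phi> G = profit A (\<lambda>j. j \<in> {j. j < k \<and> \<phi> j}) G"
proof -
  have "kept A \<phi> G (input_length G) = kept A (\<lambda>j. j \<in> {j. j < k \<and> \<phi> j}) G (input_length G)"
  proof (rule kept_cong)
    fix i assume "i < input_length G"
    then show "decision A \<phi> G i = decision A (\<lambda>j. j \<in> {j. j < k \<and> \<phi> j}) G i"
      using assms[unfolded reads_at_most_def, rule_format, of "\<lambda>j. j \<in> {j. j < k \<and> \<phi> j}" i]
      by simp
  qed
  then show ?thesis by (simp only: profit_def)
qed

section \<open>Exponential moment of the number of hits\<close>

text \<open>\<open>C g r\<close> is fixed by the values of \<open>g\<close> before \<open>r\<close>,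
  so at most \<open>s\<close> of the \<open>q\<close> choices of \<open>g r\<close> hit it. A hit
  doubles the summand, so each coordinate contributes a factor of at most
  \<open>(q - s) + 2 * s = q + s\<close>, whatever the earlier values are.\<close>

lemma sum_two_power_hits:
  fixes C :: "(nat \<Rightarrow> nat) \<Rightarrow> nat \<Rightarrow> nat set"
  assumes "\<And>r g g'. (\<And>i. i < r \<Longrightarrow> g i = g' i) \<Longrightarrow> C g r = C g' r"
    and "\<And>g r. r < m \<Longrightarrow> C g r \<subseteq> {..<q}" "\<And>g r. r < m \<Longrightarrow> card (C g r) \<le> s"
  shows "(\<Sum>g\<in>{..<m} \<rightarrow>\<^sub>E {..<q}. 2 ^ card {r. r < m \<and> g r \<in> C g r}) \<le> (q + s) ^ m"
  using assms(2,3)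
proof (induction m)
  case 0
  then show ?case by simp
next
  case (Suc m)
  let ?h = "\<lambda>g. card {r. r < m \<and> g r \<in> C g r}"
  let ?P = "{..<m} \<rightarrow>\<^sub>E {..<q}"
  \<comment> \<open>The value at \<open>m\<close> may vary freely: the sets up to and including
    \<open>C g m\<close> look only at smaller arguments.\<close>
  have C: "C (g(m := j)) r = C g r" if "r \<le> m" for g j r
    by (rule assms(1)) (use that in auto)
  have hits: "{r. r < Suc m \<and> (g(m := j)) r \<in> C (g(m := j)) r}
      = {r. r < m \<and> g r \<in> C g r} \<union> (if j \<in> C g m then {m} else {})" for g j
    by (auto simp: C less_Suc_eq)
  have card: "card {r. r < Suc m \<and> (g(m := j)) r \<in> C (g(m := j)) r}
      = ?h g + (if j \<in> C g m then 1 else 0)" for g j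
    unfolding hits by simp
  have inner: "(\<Sum>j<q. 2 ^ (?h g + (if j \<in> C g m then 1 else 0))) \<le> (2::nat) ^ ?h g * (q + s)" for g
  proof -
    have "(\<Sum>j<q. (2::nat) ^ (?h g + (if j \<in> C g m then 1 else 0)))
        = (\<Sum>j<q. 2 ^ ?h g * (1 + (if j \<in> C g m then 1 else 0)))"
      by (intro sum.cong) auto
    also have "\<dots> = 2 ^ ?h g * (q + (\<Sum>j<q. if j \<in> C g m then 1 else 0))"
      by (simp only: sum_distrib_left[symmetric] sum.distrib) simp
    also have "(\<Sum>j<q. if j \<in> C g m then 1 else 0) = card ({..<q} \<inter> C g m)"
      by (simp add: sum.If_cases)
    also have "{..<q} \<inter> C g m = C g m" using Suc.prems(1)[of m g] by auto
    finally show ?thesis using Suc.prems(2)[of m g] by simp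
  qed
  have "{..<Suc m} \<rightarrow>\<^sub>E {..<q} = (\<lambda>(j, g). g(m := j)) ` ({..<q} \<times> ?P)"
    by (simp add: lessThan_Suc PiE_insert_eq)
  moreover have "inj_on (\<lambda>(j, g). g(m := j)) ({..<q} \<times> ?P)"
    by (rule inj_combinator) simp
  ultimately have "(\<Sum>g\<in>{..<Suc m} \<rightarrow>\<^sub>E {..<q}. 2 ^ card {r. r < Suc m \<and> g r \<in> C g r})
      = (\<Sum>(j, g)\<in>{..<q} \<times> ?P. 2 ^ (?h g + (if j \<in> C g m then 1 else 0)))"
    by (simp only: sum.reindex o_def split_def card)
  also have "\<dots> = (\<Sum>g\<in>?P. \<Sum>j<q. 2 ^ (?h g + (if j \<in> C g m then 1 else 0)))"
    by (subst sum.swap) (rule sum.cartesian_product[symmetric])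
  also have "\<dots> \<le> (\<Sum>g\<in>?P. 2 ^ ?h g * (q + s))" by (intro sum_mono inner)
  also have "\<dots> = (\<Sum>g\<in>?P. 2 ^ ?h g) * (q + s)" by (simp add: sum_distrib_right)
  also have "\<dots> \<le> (q + s) ^ m * (q + s)"
    using Suc by (intro mult_le_mono1 Suc.IH) auto
  finally show ?case by (simp only: power_Suc2)
qed

section \<open>The hard instances and the count of advice strings\<close>

text \<open>Under the stated correspondence \<open>f\<close> is an isomorphism from the subgraph
  induced by \<open>S\<close>, which moves membership in \<pi> to one of the Ramsey graphs. Only
  pairs with \<open>u < v\<close> are compared because the instances define adjacency by order of
  arrival.\<close>

lemma pullback_in_property:
  assumes \<pi>: "graph_property \<pi>" and G: "simple_graph G" "S \<subseteq> verts G" "induced G S \<in> \<pi>"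
    and f: "inj_on f S"
    and iff: "\<And>u v. u \<in> S \<Longrightarrow> v \<in> S \<Longrightarrow> u < v \<Longrightarrow> {u, v} \<in> edges G \<longleftrightarrow> {f u, f v} \<in> E"
  shows "Graph (f ` S) (E \<inter> [f ` S]\<^bsup>2\<^esup>) \<in> \<pi>"
proof -
  have "e \<in> edges G \<longleftrightarrow> f ` e \<in> E" if "e \<in> [S]\<^bsup>2\<^esup>" for e
  proof -
    have e: "card e = 2" "e \<subseteq> S" using that by (auto simp: nsets_def)
    then obtain x y where "e = {x, y}" "x \<noteq> y" by (auto simp: card_2_iff)
    then have xy: "e = {x, y}" "x \<noteq> y" "x \<in> S" "y \<in> S" using e by auto
    obtain u v where "e = {u, v}" "u \<in> S" "v \<in> S" "u < v"
    proof (cases "x < y")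
      case True
      then show ?thesis using that xy by blast
    next
      case False
      then show ?thesis using that[of y x] xy by (simp add: insert_commute)
    qed
    then show ?thesis using iff by simp
  qed
  then have "(\<lambda>e. f ` e) ` (edges G \<inter> [S]\<^bsup>2\<^esup>) = E \<inter> [f ` S]\<^bsup>2\<^esup>"
    unfolding nsets_image_inj[OF f] by blast
  moreover have "simple_graph (induced G S)" using \<pi> G(3) by (simp add: graph_property_def)
  moreover have "verts (induced G S) = S" using G(2) by (auto simp: induced_def)
  moreover have "edges (induced G S) = edges G \<inter> [S]\<^bsup>2\<^esup>" by (simp add: induced_def)
  ultimately show ?thesis
    using isomorphic_image(1,2)[of "induced G S" f] f \<pi> G(3) unfolding graph_property_def by metis
qed

lemma induced_induced: "T \<subseteq> S \<Longrightarrow> induced (induced G S) T = induced G T"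
  using nsets_mono[of T S 2] by (auto simp: induced_def)

text \<open>\<open>E\<close> is the Ramsey graph on the \<open>q\<close> positions of a round and
  \<open>F\<close> the one on the \<open>m\<close> rounds; \<open>s\<close> and \<open>t\<close>
  abstract from their logarithmic bounds.\<close>

locale hard_instances =
  fixes \<pi> :: "graph set" and A :: algorithm and E F :: "nat set set" and q m s t :: nat
  assumes \<pi>: "graph_property \<pi>" and edgeless: "\<And>G. simple_graph G \<Longrightarrow> edges G = {} \<Longrightarrow> G \<in> \<pi>"
    and her: "hereditary \<pi>" and A: "max_algorithm \<pi> A" and q: "q > 0"
    and E: "\<And>S. S \<subseteq> {..<q} \<Longrightarrow> Graph S (E \<inter> [S]\<^bsup>2\<^esup>) \<in> \<pi> \<Longrightarrow> card S \<le> s"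
    and F: "\<And>S. S \<subseteq> {..<m} \<Longrightarrow> Graph S (F \<inter> [S]\<^bsup>2\<^esup>) \<in> \<pi> \<Longrightarrow> card S \<le> t"
begin

text \<open>Vertex \<open>u\<close> arrives in round \<open>u div q\<close>. The graph is the lexicographic product of \<open>F\<close>
  and \<open>E\<close>, from which all edges between \<open>g r\<close>, the hidden vertex of round \<open>r\<close>, and later rounds
  are deleted.\<close>
definition inst :: "(nat \<Rightarrow> nat) \<Rightarrow> graph" where
  "inst g = Graph {..<m * q} {{u, v} | u v. u < v \<and> v < m * q \<and>
     (if u div q = v div q then {u mod q, v mod q} \<in> E
      else u mod q \<noteq> g (u div q) \<and> {u div q, v div q} \<in> F)}"

lemma edge_iff:
  assumes "u < v"
  shows "{u, v} \<in> edges (inst g) \<longleftrightarrow> v < m * q \<and>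
     (if u div q = v div q then {u mod q, v mod q} \<in> E
      else u mod q \<noteq> g (u div q) \<and> {u div q, v div q} \<in> F)"
  using assms by (auto simp: inst_def doubleton_eq_iff)

lemma verts_inst [simp]: "verts (inst g) = {..<m * q}"
  by (simp add: inst_def)

lemma simple_inst: "simple_graph (inst g)"
  by (auto simp: simple_graph_def inst_def nsets_def)

lemma online_inst: "online_input (inst g)"
  using simple_inst by (auto simp: online_input_def)

lemma edge_doubleton: "e \<in> edges (inst g) \<Longrightarrow> \<exists>u v. e = {u, v} \<and> u < v"
  by (auto simp: inst_def)

text \<open>An edge consults \<open>g\<close> only at the round of its earlier endpoint, and only if
  the later endpoint lies in a later round. Hence all that is revealed up to the end of round
  \<open>r\<close> is independent of \<open>g r\<close>.\<close>

lemma induced_inst_cong: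
  assumes "\<And>i. i < r \<Longrightarrow> g i = g' i" "j < Suc r * q"
  shows "induced (inst g) {..j} = induced (inst g') {..j}"
proof -
  have aux: "edges (inst h) \<inter> [{..j}]\<^bsup>2\<^esup> \<subseteq> edges (inst h')"
    if h: "\<And>i. i < r \<Longrightarrow> h i = h' i" for h h'
  proof
    fix e assume e: "e \<in> edges (inst h) \<inter> [{..j}]\<^bsup>2\<^esup>"
    then obtain u v where uv: "e = {u, v}" "u < v" using edge_doubleton by blast
    have "v \<le> j" using e uv by (auto simp: nsets_def)
    then have "v div q < Suc r" using assms(2) q by (simp add: div_less_iff_less_mult)
    moreover have "u div q \<le> v div q" using uv by (simp add: div_le_mono)
    ultimately have "h (u div q) = h' (u div q)" if "u div q \<noteq> v div q" using h that by auto
    then show "e \<in> edges (inst h')" using e uv by (auto simp: edge_iff split: if_splits)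
  qed
  from aux[of g g'] aux[of g' g] assms(1) show ?thesis
    by (auto simp: induced_def)
qed

lemma kept_inst_cong:
  assumes "\<And>i. i < r \<Longrightarrow> g i = g' i"
  shows "kept A \<phi> (inst g) (Suc r * q) = kept A \<phi> (inst g') (Suc r * q)"
  by (rule kept_cong) (simp only: decision_def induced_inst_cong[OF assms])

text \<open>Inside a single round the map to positions \<open>u mod q\<close> identifies the
  instance with \<open>E\<close>.\<close>

lemma round_small:
  assumes "r < m" "Z \<subseteq> {u. u div q = r}" "induced (inst g) Z \<in> \<pi>"
  shows "card Z \<le> s"
proof -
  have inj: "inj_on (\<lambda>u. u mod q) Z"
  proof (rule inj_onI)
    fix u v assume uv: "u \<in> Z" "v \<in> Z" "u mod q = v mod q"
    then have "u div q = v div q" using assms(2) by auto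
    then show "u = v" using uv(3) by (metis div_mod_decomp)
  qed
  have Z: "u < m * q" if "u \<in> Z" for u
    using assms(1,2) q that by (auto simp: div_less_iff_less_mult[symmetric])
  have "Graph ((\<lambda>u. u mod q) ` Z) (E \<inter> [(\<lambda>u. u mod q) ` Z]\<^bsup>2\<^esup>) \<in> \<pi>"
  proof (rule pullback_in_property[OF \<pi> simple_inst _ assms(3) inj])
    show "Z \<subseteq> verts (inst g)" using Z by auto
    fix u v assume "u \<in> Z" "v \<in> Z" "u < v"
    moreover have "u div q = r" "v div q = r" using assms(2) calculation by auto
    ultimately show "{u, v} \<in> edges (inst g) \<longleftrightarrow> {u mod q, v mod q} \<in> E"
      using Z by (simp add: edge_iff)
  qed
  then have "card ((\<lambda>u. u mod q) ` Z) \<le> s" using q by (intro E) auto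
  then show ?thesis by (simp add: card_image[OF inj])
qed

lemma induced_subset: "induced G S \<in> \<pi> \<Longrightarrow> S \<subseteq> verts G \<Longrightarrow> T \<subseteq> S \<Longrightarrow> induced G T \<in> \<pi>"
proof -
  assume *: "induced G S \<in> \<pi>" "S \<subseteq> verts G" "T \<subseteq> S"
  then have "T \<subseteq> verts (induced G S)" by (auto simp: induced_def)
  then have "induced (induced G S) T \<in> \<pi>" using her *(1) by (simp add: hereditary_def)
  then show ?thesis using induced_induced[OF *(3)] by simp
qed

text \<open>One representative from each round that \<open>Z\<close> meets gives a copy of an
  induced subgraph of \<open>F\<close>, since no representative is hidden; so \<open>Z\<close> meets
  at most \<open>t\<close> rounds. Each round contributes at most \<open>s\<close> vertices.\<close>

lemma nonhidden_small:
  assumes "Z \<subseteq> {..<m * q}" "induced (inst g) Z \<in> \<pi>" "\<And>u. u \<in> Z \<Longrightarrow> u mod q \<noteq> g (u div q)"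
  shows "card Z \<le> t * s"
proof -
  let ?R = "(\<lambda>u. u div q) ` Z"
  have finZ: "finite Z" using assms(1) finite_subset by blast
  have Rm: "?R \<subseteq> {..<m}" using assms(1) q by (auto simp: div_less_iff_less_mult)
  define rep where "rep = inv_into Z (\<lambda>u. u div q)"
  have rep: "rep r \<in> Z" "rep r div q = r" if "r \<in> ?R" for r
    using that inv_into_into[of r "\<lambda>u. u div q" Z] f_inv_into_f[of r "\<lambda>u. u div q" Z]
    by (auto simp: rep_def)
  let ?S = "rep ` ?R"
  have S: "?S \<subseteq> Z" using rep by auto
  have img: "(\<lambda>u. u div q) ` ?S = ?R" using rep(2) by (force simp: image_image)
  have inj: "inj_on (\<lambda>u. u div q) ?S" using rep(2) by (intro inj_onI) auto
  have "Graph ((\<lambda>u. u div q) ` ?S) (F \<inter> [(\<lambda>u. u div q) ` ?S]\<^bsup>2\<^esup>) \<in> \<pi>"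
  proof (rule pullback_in_property[OF \<pi> simple_inst _ _ inj])
    show "?S \<subseteq> verts (inst g)" using S assms(1) by auto
    show "induced (inst g) ?S \<in> \<pi>" using induced_subset[OF assms(2) _ S] assms(1) by simp
    fix u v assume uv: "u \<in> ?S" "v \<in> ?S" "u < v"
    then have "u div q \<noteq> v div q" using inj_onD[OF inj _ uv(1,2)] by auto
    moreover have "u mod q \<noteq> g (u div q)" "v < m * q" using S uv assms(1,3) by auto
    ultimately show "{u, v} \<in> edges (inst g) \<longleftrightarrow> {u div q, v div q} \<in> F"
      using uv(3) by (simp add: edge_iff)
  qed
  then have ct: "card ?R \<le> t" using F[OF Rm] by (simp only: img)
  have "Z = (\<Union>r\<in>?R. {u \<in> Z. u div q = r})" by auto
  then have "card Z \<le> (\<Sum>r\<in>?R. card {u \<in> Z. u div q = r})"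
    using card_UN_le[of ?R "\<lambda>r. {u \<in> Z. u div q = r}"] finZ by simp
  also have "\<dots> \<le> (\<Sum>r\<in>?R. s)"
  proof (rule sum_mono)
    fix r assume "r \<in> ?R"
    then have "r < m" using Rm by auto
    moreover have "induced (inst g) {u \<in> Z. u div q = r} \<in> \<pi>"
      using assms(1) by (intro induced_subset[OF assms(2)]) auto
    ultimately show "card {u \<in> Z. u div q = r} \<le> s" by (intro round_small) auto
  qed
  also have "\<dots> \<le> t * s" using ct by simp
  finally show ?thesis .
qed

text \<open>The kept set is inspected at the end of round \<open>r\<close>, the last moment before
  \<open>g r\<close> can influence an edge.\<close>

definition candidates :: "advice \<Rightarrow> (nat \<Rightarrow> nat) \<Rightarrow> nat \<Rightarrow> nat set" where
  "candidates \<phi> g r = {j. j < q \<and> r * q + j \<in> kept A \<phi> (inst g) (Suc r * q)}"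

text \<open>A hit means that the hidden vertex survives its own round; it may still be preempted
  later, so this only bounds the hidden vertices in the final set from above.\<close>

definition hits :: "advice \<Rightarrow> (nat \<Rightarrow> nat) \<Rightarrow> nat" where
  "hits \<phi> g = card {r. r < m \<and> g r \<in> candidates \<phi> g r}"

lemma kept_inst_in_property:
  assumes "i \<le> m * q"
  shows "induced (inst g) (kept A \<phi> (inst g) i) \<in> \<pi>" "kept A \<phi> (inst g) i \<subseteq> {..<m * q}"
  using A online_inst assms kept_subset[of A \<phi> "inst g" i] by (auto simp: max_algorithm_def)

lemma card_candidates:
  assumes "r < m"
  shows "card (candidates \<phi> g r) \<le> s"
proof -
  let ?Z = "(\<lambda>j. r * q + j) ` candidates \<phi> g r"
  have le: "Suc r * q \<le> m * q" using assms by (intro mult_le_mono1) simp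
  have "card ?Z \<le> s"
  proof (rule round_small[OF assms])
    show "?Z \<subseteq> {u. u div q = r}" by (auto simp: candidates_def)
    have "?Z \<subseteq> kept A \<phi> (inst g) (Suc r * q)"
      unfolding candidates_def by blast
    then show "induced (inst g) ?Z \<in> \<pi>"
      using induced_subset[OF kept_inst_in_property(1)[OF le]] kept_inst_in_property(2)[OF le]
      by (metis verts_inst)
  qed
  then show ?thesis by (simp add: card_image inj_on_def)
qed

lemma sum_hits: "(\<Sum>g\<in>{..<m} \<rightarrow>\<^sub>E {..<q}. 2 ^ hits \<phi> g) \<le> (q + s) ^ m"
  unfolding hits_def
proof (rule sum_two_power_hits)
  show "candidates \<phi> g r = candidates \<phi> g' r" if "\<And>i. i < r \<Longrightarrow> g i = g' i" for r g g'
    using kept_inst_cong[of r g g' \<phi>] that by (simp add: candidates_def)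
  show "candidates \<phi> g r \<subseteq> {..<q}" for g r by (auto simp: candidates_def)
qed (rule card_candidates)

text \<open>The final set splits into non-hidden vertices, at most \<open>t * s\<close> of them, and
  hidden ones. A hidden vertex kept to the end was kept at the end of its round, so its round counts
  as a hit.\<close>

lemma profit_le: "profit A \<phi> (inst g) \<le> t * s + hits \<phi> g"
proof -
  let ?Z = "kept A \<phi> (inst g) (m * q)"
  let ?B = "{u \<in> ?Z. u mod q \<noteq> g (u div q)}" and ?C = "{u \<in> ?Z. u mod q = g (u div q)}"
  note Z = kept_inst_in_property[OF order_refl, where g = g and \<phi> = \<phi>]
  have finZ: "finite ?Z" using Z(2) finite_subset by blast
  have "card ?Z = card (?B \<union> ?C)" by (rule arg_cong[of _ _ card]) auto
  then have "card ?Z \<le> card ?B + card ?C" using card_Un_le[of ?B ?C] by linarith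
  moreover have "card ?B \<le> t * s"
    using Z by (intro nonhidden_small[of _ g] induced_subset[OF Z(1)]) auto
  moreover have "card ?C \<le> hits \<phi> g"
    unfolding hits_def
  proof (rule card_inj_on_le[of "\<lambda>u. u div q"])
    show "inj_on (\<lambda>u. u div q) ?C"
    proof (rule inj_onI)
      fix u v assume uv: "u \<in> ?C" "v \<in> ?C" "u div q = v div q"
      then have "u mod q = v mod q" by auto
      then show "u = v" using uv(3) by (metis div_mod_decomp)
    qed
    show "(\<lambda>u. u div q) ` ?C \<subseteq> {r. r < m \<and> g r \<in> candidates \<phi> g r}"
    proof clarsimp
      fix u assume u: "u \<in> ?Z" "u mod q = g (u div q)"
      have um: "u div q < m" using u(1) Z(2) q by (auto simp: div_less_iff_less_mult)
      have "u < Suc (u div q) * q"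
        using q by (metis div_less_iff_less_mult lessI)
      moreover have "Suc (u div q) * q \<le> m * q" using um by (intro mult_le_mono1) simp
      ultimately have "u \<in> kept A \<phi> (inst g) (Suc (u div q) * q)"
        using kept_antimono[of "Suc (u div q) * q" "m * q" A \<phi> "inst g"] u(1) by blast
      moreover have "u div q * q + g (u div q) = u" using u(2) by (metis div_mod_decomp)
      moreover have "g (u div q) < q" using u(2) q by (metis mod_less_divisor)
      ultimately show "u div q < m \<and> g (u div q) \<in> candidates \<phi> g (u div q)"
        using um by (simp add: candidates_def)
    qed
  qed simp
  ultimately show ?thesis by (simp add: profit_def)
qed

text \<open>The hidden vertices, one per round, form an independent set: an edge between rounds
  needs an earlier endpoint that is not hidden.\<close>

lemma opt_inst_ge:
  assumes "\<And>r. r < m \<Longrightarrow> g r < q"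
  shows "m \<le> opt \<pi> (inst g)"
proof -
  let ?S = "(\<lambda>r. r * q + g r) ` {..<m}"
  have divS: "(r * q + g r) div q = r" "(r * q + g r) mod q = g r" if "r < m" for r
    using assms[OF that] q by simp_all
  have sub: "?S \<subseteq> {..<m * q}"
    using divS q by (auto simp: div_less_iff_less_mult[symmetric])
  have inj: "inj_on (\<lambda>r. r * q + g r) {..<m}" using divS by (intro inj_onI) (metis lessThan_iff)
  have "e \<notin> edges (inst g)" if e: "e \<in> [?S]\<^bsup>2\<^esup>" for e
  proof
    assume e': "e \<in> edges (inst g)"
    then obtain u v where uv: "e = {u, v}" "u < v" using edge_doubleton by blast
    have "u \<in> ?S" "v \<in> ?S" using e uv by (auto simp: nsets_def)
    then have "u mod q = g (u div q)" "u div q \<noteq> v div q" using divS uv(2) by auto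
    then show False using e' uv by (simp add: edge_iff)
  qed
  then have "edges (induced (inst g) ?S) = {}" by (auto simp: induced_def)
  moreover have "simple_graph (induced (inst g) ?S)"
    using calculation sub finite_subset[OF sub] by (auto simp: simple_graph_def induced_def)
  ultimately have "induced (inst g) ?S \<in> \<pi>" by (intro edgeless)
  then have "card ?S \<in> {card S |S. S \<subseteq> verts (inst g) \<and> induced (inst g) S \<in> \<pi>}"
    using sub by auto
  moreover have "finite {card S |S. S \<subseteq> verts (inst g) \<and> induced (inst g) S \<in> \<pi>}"
    by (rule finite_subset[of _ "card ` Pow {..<m * q}"]) auto
  ultimately have "card ?S \<le> opt \<pi> (inst g)" unfolding opt_def by (rule Max_ge[rotated])
  then show ?thesis by (simp add: card_image[OF inj])
qed

text \<open>Each \<open>g\<close> is served by some truncated string \<open>X\<close>, for which the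
  profit bound forces at least \<open>\<alpha> - t * s\<close> hits. Replacing that string by the
  sum over all \<open>2 ^ k\<close> strings and exchanging sums reduces the claim to the exponential
  moment for a fixed string.\<close>

lemma advice_count:
  assumes "\<And>g. g \<in> {..<m} \<rightarrow>\<^sub>E {..<q} \<Longrightarrow>
    \<exists>\<phi>. \<alpha> \<le> real (profit A \<phi> (inst g)) \<and> reads_at_most A \<phi> (inst g) k"
  shows "real q ^ m * 2 powr (\<alpha> - real (t * s)) \<le> 2 ^ k * real (q + s) ^ m"
proof -
  let ?P = "{..<m} \<rightarrow>\<^sub>E {..<q}"
  define adv :: "nat set \<Rightarrow> advice" where "adv X = (\<lambda>j. j \<in> X)" for X
  have finP: "finite ?P" by (simp add: finite_PiE)
  have each: "2 powr (\<alpha> - real (t * s)) \<le> (\<Sum>X\<in>Pow {..<k}. 2 ^ hits (adv X) g)" if g: "g \<in> ?P" for g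
  proof -
    obtain \<phi> where \<phi>: "\<alpha> \<le> real (profit A \<phi> (inst g))" "reads_at_most A \<phi> (inst g) k"
      using assms[OF g] by blast
    let ?X = "{j. j < k \<and> \<phi> j}"
    have "\<alpha> \<le> real (t * s + hits (adv ?X) g)"
      using \<phi>(1) profit_le[of "adv ?X" g] unfolding profit_truncated_advice[OF \<phi>(2)] adv_def by linarith
    then have "2 powr (\<alpha> - real (t * s)) \<le> 2 powr real (hits (adv ?X) g)"
      by (intro powr_mono) auto
    also have "\<dots> = 2 ^ hits (adv ?X) g" by (simp add: powr_realpow)
    also have "\<dots> \<le> (\<Sum>X\<in>Pow {..<k}. 2 ^ hits (adv X) g)"
      by (rule member_le_sum[of ?X]) auto
    finally show ?thesis .
  qed
  have "real q ^ m * 2 powr (\<alpha> - real (t * s)) = (\<Sum>g\<in>?P. 2 powr (\<alpha> - real (t * s)))"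
    by (simp add: card_PiE)
  also have "\<dots> \<le> (\<Sum>g\<in>?P. \<Sum>X\<in>Pow {..<k}. 2 ^ hits (adv X) g)" by (intro sum_mono each)
  also have "\<dots> = (\<Sum>X\<in>Pow {..<k}. \<Sum>g\<in>?P. 2 ^ hits (adv X) g)" by (rule sum.swap)
  also have "\<dots> = (\<Sum>X\<in>Pow {..<k}. real (\<Sum>g\<in>?P. 2 ^ hits (adv X) g))" by simp
  also have "\<dots> \<le> (\<Sum>X\<in>Pow {..<k}. real ((q + s) ^ m))"
    by (intro sum_mono of_nat_mono sum_hits)
  also have "\<dots> = 2 ^ k * real (q + s) ^ m" by (simp add: card_Pow)
  finally show ?thesis .
qed

end

section \<open>Numerical estimates\<close>

text \<open>The input is a single vertex: its optimum is at least 1, and no algorithm earns more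
  than 1.\<close>

lemma competitive_ratio_ge_1:
  assumes edgeless: "\<And>G. simple_graph G \<Longrightarrow> edges G = {} \<Longrightarrow> G \<in> \<pi>"
    and "competitive_with_advice \<pi> A c b" "n \<ge> 1" "c n > 0"
  shows "c n \<ge> 1"
proof -
  let ?G = "Graph {..<1} {}"
  have G: "simple_graph ?G" "online_input ?G" "input_length ?G \<le> n"
    using assms(3) by (auto simp: simple_graph_def online_input_def)
  then obtain \<phi> where \<phi>: "real (profit A \<phi> ?G) \<ge> 1 / c n * real (opt \<pi> ?G)"
    using assms(2) unfolding competitive_with_advice_def by blast
  have "induced ?G {..<1} = ?G" by (simp add: induced_def)
  then have "card {..<1::nat} \<in> {card S |S. S \<subseteq> verts ?G \<and> induced ?G S \<in> \<pi>}"
    using edgeless[OF G(1)] by (metis (mono_tags, lifting) graph.sel mem_Collect_eq order_refl)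
  moreover have "finite {card S |S. S \<subseteq> verts ?G \<and> induced ?G S \<in> \<pi>}"
    by (rule finite_subset[of _ "card ` Pow {..<1}"]) auto
  ultimately have "card {..<1::nat} \<le> opt \<pi> ?G" unfolding opt_def by (rule Max_ge[rotated])
  then have opt: "1 \<le> opt \<pi> ?G" by simp
  have "profit A \<phi> ?G \<le> card {..<1::nat}"
    unfolding profit_def using kept_subset[of A \<phi> ?G 1] by (intro card_mono) auto
  then have "1 / c n * real (opt \<pi> ?G) \<le> 1" using \<phi> by simp
  then have "real (opt \<pi> ?G) \<le> c n" using assms(4) by (simp add: field_simps)
  then show ?thesis using opt by linarith
qed

text \<open>Take \<open>L\<close> to be about \<open>2 * log 2 C\<close> plus a constant. Then
  \<open>C\<^sup>2\<close> and \<open>(5 * K * L)\<^sup>2\<close> are both at most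
  \<open>2 ^ L\<close>, and their product gives the first bound. The constant is absorbed into
  \<open>D\<close>, which is possible because \<open>c0 > 1\<close> keeps \<open>log 2 C\<close>
  away from 0.\<close>

lemma exists_log_size:
  fixes c0 :: real and K :: nat
  assumes "c0 > 1"
  obtains D :: real where "D \<ge> 1"
    "\<And>C. C \<ge> c0 \<Longrightarrow> \<exists>L\<ge>1. 5 * real K * C * real L \<le> 2 ^ L \<and> real L \<le> D * log 2 C"
proof -
  \<comment> \<open>The limit is used at \<open>x = L * ln 2\<close>, where
    \<open>exp x = 2 ^ L\<close>; this explains the factor \<open>(ln 2)\<^sup>2\<close>. The
    summand 1 keeps the denominator positive for \<open>K = 0\<close>.\<close>
  define d where "d = (ln 2)\<^sup>2 / (25 * (real K)\<^sup>2 + 1)"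
  have "d > 0" by (simp add: d_def add_nonneg_pos)
  then have "eventually (\<lambda>x::real. x ^ 2 / exp x < d) at_top"
    using tendsto_power_div_exp_0[of 2] by (rule order_tendstoD(2)[rotated])
  then obtain x0 where x0: "\<And>x::real. x \<ge> x0 \<Longrightarrow> x ^ 2 / exp x < d"
    by (auto simp: eventually_at_top_linorder)
  define L0 where "L0 = nat \<lceil>x0 / ln 2\<rceil>"
  have L0: "real L ^ 2 / 2 ^ L < 1 / (25 * (real K)\<^sup>2 + 1)" if "L \<ge> L0" for L
  proof -
    have "x0 / ln 2 \<le> real L" using that unfolding L0_def by linarith
    then have "x0 \<le> real L * ln 2" by (simp add: field_simps)
    from x0[OF this] have "(ln 2)\<^sup>2 * (real L ^ 2 / 2 ^ L) < (ln 2)\<^sup>2 * (1 / (25 * (real K)\<^sup>2 + 1))"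
      by (simp add: exp_of_nat_mult d_def power_mult_distrib mult.commute)
    then show ?thesis by (rule mult_less_cancel_left_pos[THEN iffD1, rotated]) simp
  qed
  have KL: "(5 * real K * real L)\<^sup>2 \<le> 2 ^ L" if "L \<ge> L0" for L
  proof -
    have "real L ^ 2 * (25 * (real K)\<^sup>2 + 1) < 2 ^ L"
      using L0[OF that]
      by (subst (asm) divide_less_eq, simp)
        (subst pos_less_divide_eq[symmetric], simp_all add: add_nonneg_pos)
    then have "25 * (real K)\<^sup>2 * (real L)\<^sup>2 \<le> 2 ^ L"
      by (simp add: algebra_simps) (smt (verit) zero_le_power2)
    then show ?thesis by (simp add: power_mult_distrib)
  qed
  define l0 where "l0 = log 2 c0"
  have l0: "l0 > 0" using assms by (simp add: l0_def)
  define D where "D = 2 + (L0 + 2) / l0"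
  show ?thesis
  proof (rule that[of D])
    show "D \<ge> 1" using l0 by (simp add: D_def)
  next
    fix C :: real assume C: "C \<ge> c0"
    have C1: "C > 1" using C assms by simp
    have lC: "log 2 C \<ge> l0" using C assms by (simp add: l0_def)
    define L where "L = nat \<lceil>2 * log 2 C\<rceil> + L0 + 1"
    have L: "real L \<ge> 2 * log 2 C" "real L \<le> 2 * log 2 C + 2 + real L0"
      using lC l0 by (simp_all add: L_def) linarith+
    have "real L0 + 2 \<le> (L0 + 2) / l0 * log 2 C"
      using mult_left_mono[OF lC, of "(L0 + 2) / l0"] l0 by simp
    then have LD: "real L \<le> D * log 2 C" using L(2) by (simp add: D_def algebra_simps)
    have "C\<^sup>2 = 2 powr (2 * log 2 C)"
      using C1 by (simp add: powr_powr[symmetric] mult.commute[of 2])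
    also have "\<dots> \<le> 2 powr real L" using L(1) by simp
    also have "\<dots> = 2 ^ L" by (simp add: powr_realpow)
    finally have "C\<^sup>2 \<le> 2 ^ L" .
    then have "(5 * real K * real L)\<^sup>2 * C\<^sup>2 \<le> 2 ^ L * 2 ^ L"
      using KL[of L] by (intro mult_mono) (auto simp: L_def)
    then have "(5 * real K * C * real L)\<^sup>2 \<le> (2 ^ L)\<^sup>2"
      by (simp add: power2_eq_square ac_simps)
    then have "5 * real K * C * real L \<le> 2 ^ L" by (rule power2_le_imp_le) simp
    then show "\<exists>L\<ge>1. 5 * real K * C * real L \<le> 2 ^ L \<and> real L \<le> D * log 2 C"
      using LD by (intro exI[of _ L]) (simp add: L_def)
  qed
qed

text \<open>The moment factor \<open>(1 + s / q) ^ m\<close> is at most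
  \<open>exp (m / (4 * C))\<close>, which is at most \<open>2 powr (m / (2 * C))\<close> as
  \<open>ln 2\<close> is at least 1/2. It therefore costs at most half of the gain
  \<open>m / C\<close>.\<close>

lemma advice_bits_from_count:
  fixes C :: real
  assumes "q > 0" "C > 0" "4 * C * real s \<le> real q"
    and count: "real q ^ m * 2 powr (real m / C - real z) \<le> 2 ^ k * real (q + s) ^ m"
  shows "real m / (2 * C) - real z \<le> real k"
proof -
  have "real (q + s) ^ m = real q ^ m * (1 + real s / real q) ^ m"
    using assms(1) by (simp add: power_mult_distrib[symmetric] field_simps)
  then have "2 powr (real m / C - real z) \<le> 2 ^ k * (1 + real s / real q) ^ m"
    using count assms(1) by (simp add: mult.left_commute[of "2 ^ k"])
  also have "(1 + real s / real q) ^ m \<le> exp (1 / (4 * C)) ^ m"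
  proof (rule power_mono)
    have "real s / real q \<le> 1 / (4 * C)" using assms by (simp add: field_simps)
    then show "1 + real s / real q \<le> exp (1 / (4 * C))"
      using exp_ge_add_one_self[of "1 / (4 * C)"] by linarith
  qed simp
  also have "exp (1 / (4 * C)) ^ m \<le> 2 powr (real m / (2 * C))"
  proof -
    have "exp (1 / (4 * C)) ^ m = exp (real m / (2 * C) * (1 / 2))"
      by (simp add: exp_of_nat_mult[symmetric])
    also have "\<dots> \<le> exp (real m / (2 * C) * ln 2)"
    proof -
      have "ln (1 / 2) \<le> (1 / 2 :: real) - 1" by (rule ln_le_minus_one) simp
      then have "1 / 2 \<le> ln (2 :: real)" by (simp add: ln_div)
      then show ?thesis unfolding exp_le_cancel_iff using assms by (intro mult_left_mono) auto
    qed
    finally show ?thesis by (simp add: powr_def)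
  qed
  finally have "2 powr (real m / C - real z) \<le> 2 powr (real k + real m / (2 * C))"
    by (simp add: powr_add powr_realpow)
  then have "real m / C - real z \<le> real k + real m / (2 * C)" by simp
  moreover have "real m / C = 2 * (real m / (2 * C))" by simp
  ultimately show ?thesis by linarith
qed

text \<open>With \<open>m = n div q\<close>, half of \<open>m / (2 * C)\<close> already reaches the
  target: \<open>m\<close> is at least \<open>n / (2 * q)\<close> and \<open>q\<close> at most
  \<open>5 * K * D * C * log 2 C\<close>, whence the constant 40. The other half must pay for
  \<open>K * M * (K * L)\<close>, at most \<open>2 * K\<^sup>2 * D * log 2 n * log 2 C\<close>; this
  amounts to \<open>main\<close>, and \<open>X\<close> is chosen for it.\<close>

lemma parameter_estimates:
  fixes C D :: real and K L M n q :: nat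
  defines "X \<equiv> 80 * real K ^ 3 * D\<^sup>2"
  assumes "K \<ge> 1" "D \<ge> 1" "C > 1" "n \<ge> 2"
    and L: "real L \<le> D * log 2 C" and M: "real M \<le> 2 * log 2 n"
    and q: "q > 0" "real q \<le> 5 * C * real K * real L"
    and small: "C * log 2 C \<le> 1 / X * sqrt (real n / log 2 n)"
  shows "1 / (40 * real K * D) * (real n / (C\<^sup>2 * log 2 C))
    \<le> real (n div q) / (2 * C) - real (K * M * (K * L))"
proof -
  define l where "l = log 2 C"
  define N where "N = log 2 (real n)"
  have l: "l > 0" using assms by (simp add: l_def)
  have N: "N \<ge> 1" using \<open>n \<ge> 2\<close> by (simp add: N_def le_log_iff)
  have K: "real K \<ge> 1" using \<open>K \<ge> 1\<close> by simp
  have KD: "real K * D > 0" "real K * D \<le> real K ^ 3 * D\<^sup>2"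
  proof -
    show "real K * D > 0" using K assms by simp
    have "real K ^ 1 \<le> real K ^ 3" by (rule power_increasing) (use K in auto)
    moreover have "D ^ 1 \<le> D\<^sup>2" by (rule power_increasing) (use assms in auto)
    ultimately show "real K * D \<le> real K ^ 3 * D\<^sup>2" using K assms by (intro mult_mono) auto
  qed
  have K3: "real K ^ 3 * D\<^sup>2 \<ge> 1"  using K assms by (intro mult_ge1_I one_le_power)
  have X: "X \<ge> 80" using K3 by (simp add: X_def)
  have sm: "C * l \<le> 1 / X * sqrt (real n / N)" using small by (simp add: l_def N_def)
  \<comment> \<open>Squaring the smallness assumption removes the root and yields
    \<open>main\<close> with a spare factor \<open>X\<close>.\<close>
  have "(C * l)\<^sup>2 \<le> (1 / X * sqrt (real n / N))\<^sup>2"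
    using sm l assms by (intro power_mono) auto
  also have "\<dots> = (1 / X)\<^sup>2 * (real n / N)" using N by (simp add: power_mult_distrib power_divide)
  finally have "(C * l)\<^sup>2 * N \<le> (1 / X)\<^sup>2 * (real n / N) * N" using N by (intro mult_right_mono) auto
  then have "(C * l)\<^sup>2 * N \<le> (1 / X)\<^sup>2 * real n" using N by simp
  then have "X * ((C * l)\<^sup>2 * N) \<le> X * ((1 / X)\<^sup>2 * real n)" using X by (intro mult_left_mono) auto
  also have "\<dots> = real n / X" using X by (simp add: power2_eq_square)
  also have "\<dots> \<le> real n" using X mult_right_mono[of 1 X "real n"] by (simp add: field_simps)
  finally have main: "X * ((C * l)\<^sup>2 * N) \<le> real n" .

  have q1: "real q \<le> 5 * real K * D * (C * l)"
  proof -
    have "5 * C * real K * real L \<le> 5 * C * real K * (D * l)"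
      using L assms by (intro mult_left_mono) (auto simp: l_def)
    then show ?thesis using q by (simp add: ac_simps)
  qed
  \<comment> \<open>A cruder use of the same assumption gives \<open>2 * q \<le> n\<close>, so
    rounding in \<open>n div q\<close> loses at most half.\<close>
  have "sqrt (real n / N) \<le> real n"
  proof (rule real_le_lsqrt)
    have "real n / N \<le> real n / 1" using N by (intro divide_left_mono) auto
    also have "\<dots> \<le> (real n)\<^sup>2" using \<open>n \<ge> 2\<close> by (simp add: power2_eq_square)
    finally show "real n / N \<le> (real n)\<^sup>2" .
  qed simp
  then have "1 / X * sqrt (real n / N) \<le> 1 / X * real n" using X by (intro mult_left_mono) auto
  with sm have "C * l \<le> 1 / X * real n" by linarith
  then have "X * (C * l) \<le> real n" using X by (simp add: field_simps)
  moreover have "10 * (real K * D) * (C * l) \<le> X * (C * l)"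
  proof (rule mult_right_mono)
    have "X = 80 * (real K ^ 3 * D\<^sup>2)" by (simp add: X_def)
    then show "10 * (real K * D) \<le> X" using KD by linarith
    show "0 \<le> C * l" using l \<open>C > 1\<close> by simp
  qed
  ultimately have q2: "2 * real q \<le> real n" using q1 by simp
  have "real n - real q < real q * real (n div q)"
  proof -
    have "n < q * (n div q) + q" using q(1) by (metis add.commute dividend_less_times_div)
    then have "real n < real (q * (n div q) + q)" by (simp only: of_nat_less_iff)
    then show ?thesis by simp
  qed
  then have "real n / 2 \<le> real q * real (n div q)" using q2 by simp
  also have "\<dots> \<le> 5 * real K * D * (C * l) * real (n div q)" using q1 by (intro mult_right_mono) auto
  finally have mC: "real n / (40 * real K * D * C\<^sup>2 * l) \<le> real (n div q) / (4 * C)"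
    using KD l K assms(3,4) by (simp add: field_simps power2_eq_square)
  have "real (K * M * (K * L)) \<le> real K * (2 * N) * (real K * (D * l))"
    using L M assms by (simp add: l_def N_def mult_mono)
  also have "\<dots> \<le> real n / (40 * real K * D * C\<^sup>2 * l)"
    using main KD l K assms(3,4) by (simp add: X_def field_simps power2_eq_square power3_eq_cube)
  finally have "real (K * M * (K * L)) \<le> real n / (40 * real K * D * C\<^sup>2 * l)" .
  then have "real n / (40 * real K * D * C\<^sup>2 * l) \<le> real (n div q) / (2 * C) - real (K * M * (K * L))"
    using mC by simp
  then show ?thesis by (simp add: l_def ac_simps)
qed

section \<open>Choice of the parameters and the asymptotic bound\<close>

theorem theorem15:
  fixes \<pi> :: "graph set" and H :: graph and c :: "nat \<Rightarrow> real"
    and A :: algorithm and b :: "nat \<Rightarrow> nat"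
  assumes "graph_property \<pi>" and "nontrivial_property \<pi>" and "hereditary \<pi>"
    and "simple_graph H" and "H \<notin> \<pi>"
    and "\<And>G. simple_graph G \<Longrightarrow> edges G = {} \<Longrightarrow> G \<in> \<pi>"
    and "\<And>n. c n > 0" and "mono c"
    and "(\<lambda>n. c n * log 2 (c n)) \<in> o(\<lambda>n. sqrt (real n / log 2 (real n)))"
    and "max_algorithm \<pi> A"
    and "competitive_with_advice \<pi> A c b"
  shows "(\<lambda>n. real (b n)) \<in> \<Omega>(\<lambda>n. real n / ((c n)\<^sup>2 * log 2 (c n)))"
proof (cases "\<exists>n. c n > 1")
  case False
  \<comment> \<open>Here the logarithm is 0 and division by zero yields 0, so the claimed lower
    bound is the zero function for \<open>n \<ge> 1\<close>.\<close>
  have "c n = 1" if "n \<ge> 1" for n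
    using False competitive_ratio_ge_1[OF assms(6,11) that assms(7)] by (metis less_eq_real_def)
  then have "eventually (\<lambda>n. 1 * norm (real n / ((c n)\<^sup>2 * log 2 (c n))) \<le> norm (real (b n))) at_top"
    by (intro eventually_mono[OF eventually_ge_at_top[of 1]]) simp
  then show ?thesis by (rule landau_omega.bigI[rotated]) simp
next
  case True
  \<comment> \<open>By monotonicity \<open>c n\<close> stays at least \<open>c n0 > 1\<close> from
    \<open>n0\<close> on, so one constant \<open>D\<close> serves all large
    \<open>n\<close>.\<close>
  then obtain n0 where n0: "c n0 > 1" by blast
  have "verts H \<noteq> {}"
  proof
    assume "verts H = {}"
    then have "edges H = {}" using assms(4) by (auto simp: simple_graph_def nsets_def)
    then show False using assms(4,5,6) by blast
  qed
  then obtain K where K: "K \<ge> 1" and host: "\<And>L. L \<ge> 1 \<Longrightarrow>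
      \<exists>E. \<forall>S\<subseteq>{..<2 ^ L}. Graph S (E \<inter> [S]\<^bsup>2\<^esup>) \<in> \<pi> \<longrightarrow> card S < K * L"
    using ramsey_hosts[OF assms(1,3,4,5)] by metis
  obtain D where D: "D \<ge> 1"
    and Lex: "\<And>C. C \<ge> c n0 \<Longrightarrow> \<exists>L\<ge>1. 5 * real K * C * real L \<le> 2 ^ L \<and> real L \<le> D * log 2 C"
    using exists_log_size[OF n0, of K] by metis
  define X where "X = 80 * real K ^ 3 * D\<^sup>2"
  have "1 / X > 0" using K D by (simp add: X_def)
  then have ev: "eventually (\<lambda>n. norm (c n * log 2 (c n)) \<le> 1 / X * norm (sqrt (real n / log 2 (real n)))) at_top"
    using landau_o.smallD[OF assms(9)] by blast
  have bound: "1 / (40 * real K * D) * norm (real n / ((c n)\<^sup>2 * log 2 (c n))) \<le> norm (real (b n))"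
    if n: "n \<ge> n0" "n \<ge> 2"
      and small: "norm (c n * log 2 (c n)) \<le> 1 / X * norm (sqrt (real n / log 2 (real n)))" for n
  proof -
    define C where "C = c n"
    have C: "C \<ge> c n0" "C > 1" using assms(8) n n0 by (auto simp: C_def mono_def less_le_trans)
    obtain L where L: "L \<ge> 1" "5 * real K * C * real L \<le> 2 ^ L" "real L \<le> D * log 2 C"
      using Lex[OF C(1)] by blast
    \<comment> \<open>With \<open>s = K * L\<close> this makes a hit have probability at most
      \<open>1 / (4 * C)\<close>. Since \<open>C * K * L\<close> is at least 1, rounding up stays
      below \<open>5 * C * K * L\<close>, which \<open>L\<close> was chosen to keep within the
      \<open>2 ^ L\<close> vertices of the host graph.\<close>
    define q where "q = nat \<lceil>4 * C * real K * real L\<rceil>"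
    have CKL: "C * real K * real L \<ge> 1"
      using C(2) K L(1) by (intro mult_ge1_I) auto
    then have q_bounds: "4 * C * real K * real L \<le> real q" "real q \<le> 5 * C * real K * real L"
      unfolding q_def by linarith+
    have q0: "q > 0" using q_bounds(1) CKL by (intro Nat.gr0I) simp
    have "5 * C * real K * real L = 5 * real K * C * real L" by (simp only: ac_simps)
    then have "real q \<le> 2 ^ L" using q_bounds(2) L(2) by linarith
    then have qL: "q \<le> 2 ^ L" by simp
    \<comment> \<open>The host graph for the rounds needs at least \<open>m\<close> vertices;
      \<open>2 ^ M \<ge> n \<ge> m\<close> suffices, and \<open>M\<close> stays of order
      \<open>log 2 n\<close>.\<close>
    define M where "M = nat \<lceil>log 2 (real n)\<rceil>"
    have lgn: "log 2 (real n) \<ge> 1" using n by (simp add: le_log_iff)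
    have M: "real M \<ge> log 2 (real n)" "real M \<le> 2 * log 2 (real n)" "M \<ge> 1"
      using lgn unfolding M_def by linarith+
    have "real n = 2 powr log 2 (real n)" using n by simp
    also have "\<dots> \<le> 2 powr real M" using M(1) by (intro powr_mono) auto
    finally have "real n \<le> real (2 ^ M)" by (simp add: powr_realpow)
    then have "n \<le> 2 ^ M" by (simp only: of_nat_le_iff)
    moreover define m where "m = n div q"
    ultimately have mM: "m \<le> 2 ^ M" using div_le_dividend[of n q] by linarith
    obtain E where E: "\<forall>S\<subseteq>{..<2 ^ L}. Graph S (E \<inter> [S]\<^bsup>2\<^esup>) \<in> \<pi> \<longrightarrow> card S < K * L"
      using host[OF L(1)] by blast
    obtain F where F: "\<forall>S\<subseteq>{..<2 ^ M}. Graph S (F \<inter> [S]\<^bsup>2\<^esup>) \<in> \<pi> \<longrightarrow> card S < K * M"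
      using host[OF M(3)] by blast
    interpret hard_instances \<pi> A E F q m "K * L" "K * M"
    proof
      show "card S \<le> K * L" if "S \<subseteq> {..<q}" "Graph S (E \<inter> [S]\<^bsup>2\<^esup>) \<in> \<pi>" for S
        using E that qL by (meson lessThan_subset_iff less_imp_le order_trans)
      show "card S \<le> K * M" if "S \<subseteq> {..<m}" "Graph S (F \<inter> [S]\<^bsup>2\<^esup>) \<in> \<pi>" for S
        using F that mM by (meson lessThan_subset_iff less_imp_le order_trans)
    qed (use assms q0 in auto)
    have "real q ^ m * 2 powr (real m / C - real (K * M * (K * L))) \<le> 2 ^ b n * real (q + K * L) ^ m"
    proof (rule advice_count)
      fix g assume "g \<in> {..<m} \<rightarrow>\<^sub>E {..<q}"
      then have opt: "m \<le> opt \<pi> (inst g)" by (intro opt_inst_ge) (auto simp: PiE_iff)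
      have "m * q \<le> n" by (simp add: m_def)
      then have "input_length (inst g) \<le> n" by simp
      then obtain \<phi> where \<phi>: "real (profit A \<phi> (inst g)) \<ge> 1 / C * real (opt \<pi> (inst g))"
        "reads_at_most A \<phi> (inst g) (b n)"
        using assms(11) online_inst unfolding competitive_with_advice_def C_def by blast
      have "real m / C \<le> 1 / C * real (opt \<pi> (inst g))"
        using opt C(2) by (simp add: divide_right_mono)
      then show "\<exists>\<phi>. real m / C \<le> real (profit A \<phi> (inst g)) \<and> reads_at_most A \<phi> (inst g) (b n)"
        using \<phi> by (intro exI[of _ \<phi>]) simp
    qed
    moreover have "4 * C * real (K * L) \<le> real q" using q_bounds(1) by (simp add: mult.assoc)
    ultimately have "real m / (2 * C) - real (K * M * (K * L)) \<le> real (b n)"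
      using q0 C(2) by (intro advice_bits_from_count[of q C "K * L"]) auto
    moreover have "1 / (40 * real K * D) * (real n / (C\<^sup>2 * log 2 C))
        \<le> real m / (2 * C) - real (K * M * (K * L))"
      unfolding m_def
    proof (rule parameter_estimates[OF K D C(2) n(2) L(3) M(2) q0 q_bounds(2)])
      show "C * log 2 C \<le> 1 / (80 * real K ^ 3 * D\<^sup>2) * sqrt (real n / log 2 (real n))"
        using small C(2) lgn by (simp add: X_def C_def abs_mult)
    qed
    ultimately have "1 / (40 * real K * D) * (real n / (C\<^sup>2 * log 2 C)) \<le> real (b n)" by linarith
    moreover have "norm (real n / ((c n)\<^sup>2 * log 2 (c n))) = real n / (C\<^sup>2 * log 2 C)"
      using C(2) by (simp add: C_def)
    ultimately show ?thesis by (simp only: real_norm_def abs_of_nat)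
  qed
  have "eventually (\<lambda>n. 1 / (40 * real K * D) * norm (real n / ((c n)\<^sup>2 * log 2 (c n))) \<le> norm (real (b n))) at_top"
    using ev eventually_ge_at_top[of n0] eventually_ge_at_top[of 2]
    by eventually_elim (rule bound)
  then show ?thesis
    by (rule landau_omega.bigI[rotated]) (use K D in simp)
qed

end
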